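(* For any graphs $G$ and $H$, $$\rho_e^o(G)\,\alpha(H)\le \rho_e^o(G\circ H)\le \rho_e^o(G)\,\alpha(H)+\rho_e^o(H)\bigl(\alpha(G)-\rho_e^o(G)\bigr).$$ These bounds are sharp, that is, each of the two inequalities is attained with equality by some graphs $G$ and $H$.
   Context: All graphs are finite and simple. A set $B\subseteq E(G)$ is an edge open packing set (EOP set) of $G$ if for any two distinct edges $e_1,e_2\in B$ there is no edge $e\in E(G)\setminus\{e_1,e_2\}$ joining an endvertex of $e_1$ to an endvertex of $e_2$ (that is, no edge $e$ such that $e_1,e,e_2$ form a path with middle edge $e$ or a triangle). Edges of $B$ may share an endvertex. The maximum cardinality of an EOP set is the EOP number $\rho_e^o(G)$. $\alpha(G)$ is the independence number of $G$. The lexicographic product $G\circ H$ has vertex set $V(G)\times V(H)$, and $(g,h)$, $(g',h')$ are adjacent if either $gg'\in E(G)$, or $g=g'$ and $hh'\in E(H)$. *)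

theory Defs
  imports "HOL-Library.Ramsey"
begin

text \<open>A graph is a pair of a vertex set and a set of edges, each edge being a
  two-element set of vertices.\<close>

type_synonym 'a graph = "'a set \<times> 'a set set"

abbreviation verts :: "'a graph \<Rightarrow> 'a set" where
  "verts G \<equiv> fst G"

abbreviation edges :: "'a graph \<Rightarrow> 'a set set" where
  "edges G \<equiv> snd G"

definition finite_simple_graph :: "'a graph \<Rightarrow> bool" where
  "finite_simple_graph G \<longleftrightarrow> finite (verts G) \<and> edges G \<subseteq> nsets (verts G) 2"

definition joins :: "'a set \<Rightarrow> 'a set \<Rightarrow> 'a set \<Rightarrow> bool" where
  "joins e e1 e2 \<longleftrightarrow> (\<exists>x\<in>e1. \<exists>y\<in>e2. e = {x, y})"

text \<open>The joining edge may itself belong to \<^term>\<open>B\<close>, and \<^term>\<open>e1\<close> and \<^term>\<open>e2\<close>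
  may share an endvertex; in the latter case a joining edge different from both closes a
  triangle.\<close>

definition eop_set :: "'a graph \<Rightarrow> 'a set set \<Rightarrow> bool" where
  "eop_set G B \<longleftrightarrow> B \<subseteq> edges G \<and>
     (\<forall>e1\<in>B. \<forall>e2\<in>B. e1 \<noteq> e2 \<longrightarrow> \<not> (\<exists>e\<in>edges G - {e1, e2}. joins e e1 e2))"

definition eop_number :: "'a graph \<Rightarrow> nat" where
  "eop_number G = Max {card B | B. eop_set G B}"

definition independence_number :: "'a graph \<Rightarrow> nat" where
  "independence_number G = Max {card S | S. S \<subseteq> verts G \<and> indep S (edges G)}"

definition lex_product :: "'a graph \<Rightarrow> 'b graph \<Rightarrow> ('a \<times> 'b) graph" where
  "lex_product G H =
     (verts G \<times> verts H,
      {{(g, h), (g', h')} | g h g' h'.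
         (g, h) \<in> verts G \<times> verts H \<and> (g', h') \<in> verts G \<times> verts H \<and>
         ({g, g'} \<in> edges G \<or> g = g' \<and> {h, h'} \<in> edges H)})"

lemma finite_simple_graph_lex_product:
  assumes "finite_simple_graph G" "finite_simple_graph H"
  shows "finite_simple_graph (lex_product G H)"
proof -
  have G: "g \<noteq> g'" if "{g, g'} \<in> edges G" for g g'
    using assms(1) that unfolding finite_simple_graph_def nsets_def by force
  have H: "h \<noteq> h'" if "{h, h'} \<in> edges H" for h h'
    using assms(2) that unfolding finite_simple_graph_def nsets_def by force
  show ?thesis
    using assms G H
    by (auto simp: finite_simple_graph_def lex_product_def nsets_def card_insert_if)
qed

end

theory Submission
  imports Defs
begin

text \<open>In an edge open packing set every edge has a private endvertex, lying on no other edge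
  of the set, and the private endvertices are pairwise nonadjacent.  For the lower bound, replace
  each private endvertex by a maximum independent set of the fibre above it.  For the upper bound,
  project the private endvertices of a packing of the product to an independent set of \<open>G\<close>.
  Above a projected point carrying a non-vertical edge there are at most \<open>\<alpha>(H)\<close> private
  endvertices, and the points of this kind correspond to the edges of a packing of \<open>G\<close>; above any
  other point the edges are vertical and form a packing of \<open>H\<close>.  The bound follows from
  \<open>\<rho>(H) \<le> \<alpha>(H)\<close>.  If \<open>\<alpha>(G) = \<rho>(G)\<close>, as for a single edge, both bounds coincide.\<close>

section \<open>Edges, packings and the maximum packing size\<close>

lemma edge_cases:
  assumes "finite_simple_graph G" "e \<in> edges G"
  obtains x y where "e = {x, y}" "x \<noteq> y" "x \<in> verts G" "y \<in> verts G"
  using assms unfolding finite_simple_graph_def nsets_def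
  by (auto simp: card_2_iff subset_iff)

lemma edge_subset_verts:
  assumes "finite_simple_graph G" "e \<in> edges G"
  shows "e \<subseteq> verts G"
  using assms unfolding finite_simple_graph_def nsets_def by auto

lemma edge_distinct:
  assumes "finite_simple_graph G" "{x, y} \<in> edges G"
  shows "x \<noteq> y"
  using assms unfolding finite_simple_graph_def nsets_def by force

lemma finite_edges:
  assumes "finite_simple_graph G"
  shows "finite (edges G)"
  using assms unfolding finite_simple_graph_def
  by (meson finite_imp_finite_nsets finite_subset)

text \<open>The contrapositive of the definition, with the joining edge given by its ends. Packings
  are used below in this form and built with the matching introduction rule
  \<open>eop_setI\<close>.\<close>

lemma eop_setD:
  assumes "eop_set G B" "e1 \<in> B" "e2 \<in> B" "e1 \<noteq> e2" "x \<in> e1" "y \<in> e2" "{x, y} \<in> edges G"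
  shows "{x, y} = e1 \<or> {x, y} = e2"
  using assms unfolding eop_set_def joins_def by blast

lemma eop_setI:
  assumes "B \<subseteq> edges G"
    and "\<And>e1 e2 x y. \<lbrakk>e1 \<in> B; e2 \<in> B; e1 \<noteq> e2; x \<in> e1; y \<in> e2; {x, y} \<in> edges G\<rbrakk>
           \<Longrightarrow> {x, y} = e1 \<or> {x, y} = e2"
  shows "eop_set G B"
  unfolding eop_set_def joins_def
proof (intro conjI ballI impI notI, fact assms(1))
  fix e1 e2
  assume e: "e1 \<in> B" "e2 \<in> B" "e1 \<noteq> e2"
    and "\<exists>e\<in>edges G - {e1, e2}. \<exists>x\<in>e1. \<exists>y\<in>e2. e = {x, y}"
  then obtain d x y where "d \<in> edges G - {e1, e2}" "x \<in> e1" "y \<in> e2" "d = {x, y}"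
    by metis
  then show False using assms(2)[OF e, of x y] by simp
qed

lemma finite_eop_set:
  assumes "finite_simple_graph G" "eop_set G B"
  shows "finite B"
  using finite_subset[OF _ finite_edges[OF assms(1)]] assms(2) by (simp add: eop_set_def)

lemma finite_eop_cards:
  assumes "finite_simple_graph G"
  shows "finite {card B | B. eop_set G B}"
proof -
  have "{card B | B. eop_set G B} \<subseteq> card ` Pow (edges G)"
    unfolding eop_set_def by blast
  then show ?thesis
    using finite_edges[OF assms] by (meson finite_Pow_iff finite_imageI finite_subset)
qed

lemma card_le_eop_number:
  assumes "finite_simple_graph G" "eop_set G B"
  shows "card B \<le> eop_number G"
  unfolding eop_number_def using assms finite_eop_cards by (intro Max_ge) blast+

lemma eop_number_attained:
  assumes "finite_simple_graph G"
  obtains B where "eop_set G B" "card B = eop_number G"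
proof -
  have "eop_set G {}" by (simp add: eop_set_def)
  then have "{card B | B. eop_set G B} \<noteq> {}" by blast
  from Max_in[OF finite_eop_cards[OF assms] this] show thesis
    using that unfolding eop_number_def by auto
qed

section \<open>Maximum independent sets and private endvertices\<close>

lemma finite_indep_cards:
  assumes "finite_simple_graph G"
  shows "finite {card S | S. S \<subseteq> verts G \<and> indep S (edges G)}"
proof -
  have "{card S | S. S \<subseteq> verts G \<and> indep S (edges G)} \<subseteq> card ` Pow (verts G)"
    by blast
  then show ?thesis
    using assms unfolding finite_simple_graph_def
    by (meson finite_Pow_iff finite_imageI finite_subset)
qed

lemma card_le_independence_number:
  assumes "finite_simple_graph G" "S \<subseteq> verts G" "indep S (edges G)"
  shows "card S \<le> independence_number G"
  unfolding independence_number_def using assms finite_indep_cards by (intro Max_ge) blast+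

lemma independence_number_attained:
  assumes "finite_simple_graph G"
  obtains S where "S \<subseteq> verts G" "indep S (edges G)" "card S = independence_number G"
proof -
  have "indep {} (edges G)" by (simp add: indep_def)
  then have "{card S | S. S \<subseteq> verts G \<and> indep S (edges G)} \<noteq> {}" by blast
  from Max_in[OF finite_indep_cards[OF assms] this] show thesis
    using that unfolding independence_number_def by auto
qed

text \<open>An edge whose two endvertices both lie on other edges of the packing would join those.\<close>

lemma eop_set_private_vertices:
  assumes G: "finite_simple_graph G" and B: "eop_set G B"
  obtains l where "\<And>e. e \<in> B \<Longrightarrow> l e \<in> e"
    "\<And>e e'. \<lbrakk>e \<in> B; e' \<in> B; l e \<in> e'\<rbrakk> \<Longrightarrow> e' = e"
    "l ` B \<subseteq> verts G" "indep (l ` B) (edges G)"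
proof -
  have BE: "B \<subseteq> edges G" using B by (simp add: eop_set_def)
  have "\<exists>v\<in>e. \<forall>e'\<in>B. v \<in> e' \<longrightarrow> e' = e" if e: "e \<in> B" for e
  proof (rule ccontr)
    assume neg: "\<not> ?thesis"
    obtain x y where xy: "e = {x, y}" "x \<noteq> y"
      using e BE by (blast elim: edge_cases[OF G])
    obtain e1 where e1: "e1 \<in> B" "x \<in> e1" "e1 \<noteq> e" using neg xy by blast
    obtain e2 where e2: "e2 \<in> B" "y \<in> e2" "e2 \<noteq> e" using neg xy by blast
    obtain a b where ab: "e1 = {a, b}" using e1(1) BE by (blast elim: edge_cases[OF G])
    \<comment> \<open>If they coincided, this two-element edge would contain both \<open>x\<close>
      and \<open>y\<close>, hence be \<open>e\<close>. So \<open>e\<close> is a third edge joining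
      \<open>e1\<close> to \<open>e2\<close>.\<close>
    have "e1 \<noteq> e2" using ab e1 e2 xy by auto
    then show False using eop_setD[OF B e1(1) e2(1) _ e1(2) e2(2)] e1(3) e2(3) xy e BE by auto
  qed
  then obtain l where l: "\<And>e. e \<in> B \<Longrightarrow> l e \<in> e"
    and priv: "\<And>e e'. \<lbrakk>e \<in> B; e' \<in> B; l e \<in> e'\<rbrakk> \<Longrightarrow> e' = e" by metis
  have "l e \<in> verts G" if "e \<in> B" for e
    using l[OF that] edge_subset_verts[OF G] that BE by blast
  moreover have "indep (l ` B) (edges G)"
  proof -
    have "{l e1, l e2} \<notin> edges G" if e: "e1 \<in> B" "e2 \<in> B" "l e1 \<noteq> l e2" for e1 e2
    proof
      assume "{l e1, l e2} \<in> edges G"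
      then have "{l e1, l e2} = e1 \<or> {l e1, l e2} = e2"
        using eop_setD[OF B e(1,2) _ l l] e by blast
      then show False using priv e by blast
    qed
    then show ?thesis unfolding indep_def by blast
  qed
  ultimately show thesis using that l priv by blast
qed

text \<open>The choice of private endvertices is injective, so a maximum packing yields an
  independent set of the same size.\<close>

lemma eop_number_le_independence_number:
  assumes G: "finite_simple_graph G"
  shows "eop_number G \<le> independence_number G"
proof -
  obtain B where B: "eop_set G B" "card B = eop_number G" by (rule eop_number_attained[OF G])
  obtain l where l: "\<And>e. e \<in> B \<Longrightarrow> l e \<in> e"
    "\<And>e e'. \<lbrakk>e \<in> B; e' \<in> B; l e \<in> e'\<rbrakk> \<Longrightarrow> e' = e"
    "l ` B \<subseteq> verts G" "indep (l ` B) (edges G)"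
    by (rule eop_set_private_vertices[OF G B(1)]) blast
  have "inj_on l B" by (rule inj_onI) (metis l(1,2))
  then show ?thesis
    using card_le_independence_number[OF G l(3,4)] B(2) by (simp add: card_image)
qed

section \<open>Adjacency in the lexicographic product and the lower bound\<close>

lemma verts_lex_product: "verts (lex_product G H) = verts G \<times> verts H"
  by (simp add: lex_product_def)

lemma lex_product_edge_iff:
  "{p, q} \<in> edges (lex_product G H) \<longleftrightarrow>
     p \<in> verts G \<times> verts H \<and> q \<in> verts G \<times> verts H \<and>
     ({fst p, fst q} \<in> edges G \<or> fst p = fst q \<and> {snd p, snd q} \<in> edges H)"
proof -
  obtain g h g' h' where "p = (g, h)" "q = (g', h')" by (metis surj_pair)
  then show ?thesis
    by (auto simp: lex_product_def doubleton_eq_iff insert_commute)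
qed

text \<open>Each edge \<open>e\<close> of a maximum packing of \<open>G\<close> is blown up to a
  star with one leaf for every element of a maximum independent set \<open>S\<close> of
  \<open>H\<close>. Since all second coordinates lie in \<open>S\<close>, every product edge between
  vertices of these stars projects to an edge of \<open>G\<close>, where the packing property
  applies.\<close>

lemma eop_number_lex_product_ge:
  fixes G :: "'a graph" and H :: "'b graph"
  assumes G: "finite_simple_graph G" and H: "finite_simple_graph H"
  shows "eop_number G * independence_number H \<le> eop_number (lex_product G H)"
\<comment> \<open>The construction needs an element \<open>h0\<close> of \<open>S\<close>; if there
  is none, the left-hand side is 0.\<close>
proof (cases "independence_number H = 0")
  case False
  obtain B where B: "eop_set G B" "card B = eop_number G" by (rule eop_number_attained[OF G])
  obtain S where S: "S \<subseteq> verts H" "indep S (edges H)" "card S = independence_number H"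
    by (rule independence_number_attained[OF H])
  obtain h0 where h0: "h0 \<in> S" using False S(3) by fastforce
  obtain l where l: "\<And>e. e \<in> B \<Longrightarrow> l e \<in> e"
    and priv: "\<And>e e'. \<lbrakk>e \<in> B; e' \<in> B; l e \<in> e'\<rbrakk> \<Longrightarrow> e' = e"
    by (rule eop_set_private_vertices[OF G B(1)]) blast
  have BE: "B \<subseteq> edges G" using B by (simp add: eop_set_def)
  have "\<exists>c. {c, l e} = e \<and> c \<noteq> l e \<and> c \<in> verts G \<and> l e \<in> verts G" if e: "e \<in> B" for e
  proof -
    obtain x y where "e = {x, y}" "x \<noteq> y" "x \<in> verts G" "y \<in> verts G"
      using e BE by (blast elim: edge_cases[OF G])
    moreover have "l e = x \<or> l e = y" using l[OF e] calculation(1) by blast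
    ultimately show ?thesis by (metis insert_commute)
  qed
  then obtain c where c: "\<And>e. e \<in> B \<Longrightarrow> {c e, l e} = e"
    "\<And>e. e \<in> B \<Longrightarrow> c e \<noteq> l e" "\<And>e. e \<in> B \<Longrightarrow> c e \<in> verts G" "\<And>e. e \<in> B \<Longrightarrow> l e \<in> verts G"
    by metis
  \<comment> \<open>One \<open>h0\<close> serves all edges. Edges of \<open>B\<close> with a common
    endvertex share it as \<open>c e\<close>, so their stars get the same centre; with different
    centres, an edge from one centre to a leaf of the other star would violate the packing
    property.\<close>
  define f where "f = (\<lambda>(e, s). {(c e, h0), (l e, s)})"
  have fst_f: "fst ` f (e, s) = e" if "e \<in> B" for e s
    using c(1)[OF that] by (simp add: f_def)
  have inj: "inj_on f (B \<times> S)"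
  proof (rule inj_onI, clarify)
    fix e s e' s' assume a: "e \<in> B" "s \<in> S" "e' \<in> B" "s' \<in> S" "f (e, s) = f (e', s')"
    have "e = e'" using fst_f a by metis
    moreover from this have "s = s'"
      using a(5) c(2)[OF a(1)] by (auto simp: f_def doubleton_eq_iff)
    ultimately show "e = e' \<and> s = s'" by simp
  qed
  have "eop_set (lex_product G H) (f ` (B \<times> S))"
  proof (rule eop_setI)
    have "f (e, s) \<in> edges (lex_product G H)" if "e \<in> B" "s \<in> S" for e s
      using that c[OF that(1)] BE S(1) h0 by (auto simp: f_def lex_product_edge_iff)
    then show "f ` (B \<times> S) \<subseteq> edges (lex_product G H)" by blast
  next
    fix d d' p q
    assume "d \<in> f ` (B \<times> S)" "d' \<in> f ` (B \<times> S)" and ne: "d \<noteq> d'" and p: "p \<in> d" and q: "q \<in> d'"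
      and pq: "{p, q} \<in> edges (lex_product G H)"
    then obtain e s e' s' where d: "d = f (e, s)" "e \<in> B" "s \<in> S" and d': "d' = f (e', s')" "e' \<in> B" "s' \<in> S"
      by blast
    have "snd p \<in> S" "snd q \<in> S" using p q d d' h0 by (auto simp: f_def)
    then have "{snd p, snd q} \<notin> edges H"
      using S(2) edge_distinct[OF H, of "snd p" "snd q"] by (auto simp: indep_def)
    then have E: "{fst p, fst q} \<in> edges G" using pq by (simp add: lex_product_edge_iff)
    have fne: "fst p \<noteq> fst q" by (rule edge_distinct[OF G E])
    have p': "fst p \<in> e" "p = (c e, h0) \<or> p = (l e, s)"
      using p d fst_f[OF d(2), of s] by (blast, simp add: f_def)
    have q': "fst q \<in> e'" "q = (c e', h0) \<or> q = (l e', s')"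
      using q d' fst_f[OF d'(2), of s'] by (blast, simp add: f_def)
    show "{p, q} = d \<or> {p, q} = d'"
    proof (cases "e = e'")
      case True
      \<comment> \<open>Both edges belong to one star. As \<open>p\<close> and \<open>q\<close> have
        different first coordinates, one is the centre and the other a leaf of \<open>d\<close> or
        \<open>d'\<close>.\<close>
      then show ?thesis using p' q' d d' fne by (auto simp: f_def)
    next
      case False
      from eop_setD[OF B(1) d(2) d'(2) False p'(1) q'(1) E] show ?thesis
      proof
        \<comment> \<open>Here \<open>fst q\<close> lies on both \<open>e\<close> and
          \<open>e'\<close>, so it is private to neither. Thus \<open>q\<close> is the common centre
          of the two stars and \<open>p\<close> is the leaf of \<open>d\<close>. The other case is
          symmetric.\<close>
        assume e: "{fst p, fst q} = e"
        then have "fst q \<in> e" by blast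
        then have "fst q \<noteq> l e'" "fst q \<noteq> l e" using priv d(2) d'(2) False q'(1) by metis+
        then have "q = (c e, h0)" "fst p = l e"
          using q' c(1)[OF d(2)] e fne by (auto simp: doubleton_eq_iff)
        then show ?thesis using p' c(2)[OF d(2)] d(1) by (auto simp: f_def)
      next
        assume e: "{fst p, fst q} = e'"
        then have "fst p \<in> e'" by blast
        then have "fst p \<noteq> l e'" "fst p \<noteq> l e" using priv d(2) d'(2) False p'(1) by metis+
        then have "p = (c e', h0)" "fst q = l e'"
          using p' c(1)[OF d'(2)] e fne by (auto simp: doubleton_eq_iff)
        then show ?thesis using q' c(2)[OF d'(2)] d'(1) by (auto simp: f_def)
      qed
    qed
  qed
  then have "card (f ` (B \<times> S)) \<le> eop_number (lex_product G H)"
    by (rule card_le_eop_number[OF finite_simple_graph_lex_product[OF G H]])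
  then show ?thesis
    using card_image[OF inj] B(2) S(3) by (simp add: card_cartesian_product)
qed simp

section \<open>The upper bound, by counting a maximum packing along the fibres of a
  projection\<close>

lemma eop_number_lex_product_le:
  fixes G :: "'a graph" and H :: "'b graph"
  assumes G: "finite_simple_graph G" and H: "finite_simple_graph H"
  shows "eop_number (lex_product G H) \<le> eop_number G * independence_number H
           + eop_number H * (independence_number G - eop_number G)"
proof -
  let ?P = "lex_product G H"
  have P: "finite_simple_graph ?P" by (rule finite_simple_graph_lex_product[OF G H])
  obtain B where B: "eop_set ?P B" "card B = eop_number ?P" by (rule eop_number_attained[OF P])
  have BE: "B \<subseteq> edges ?P" using B by (simp add: eop_set_def)
  have finB: "finite B" by (rule finite_eop_set[OF P B(1)])
  obtain l where l: "\<And>e. e \<in> B \<Longrightarrow> l e \<in> e"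
    and priv: "\<And>e e'. \<lbrakk>e \<in> B; e' \<in> B; l e \<in> e'\<rbrakk> \<Longrightarrow> e' = e"
    and lI: "indep (l ` B) (edges ?P)"
    by (rule eop_set_private_vertices[OF P B(1)]) blast
  have BV: "p \<in> verts G \<times> verts H" if "e \<in> B" "p \<in> e" for e p
    using edge_subset_verts[OF P, of e] BE that by (auto simp: verts_lex_product)
  have lV': "l e \<in> verts G \<times> verts H" if "e \<in> B" for e
    using BV l that by blast
  have inj: "inj_on l B" by (rule inj_onI) (metis l priv)
  have nonadj: "{l e, l e'} \<notin> edges ?P" if "e \<in> B" "e' \<in> B" for e e'
    using that lI edge_distinct[OF P] unfolding indep_def by blast
  define \<pi> where "\<pi> e = fst (l e)" for e
  \<comment> \<open>Adjacent projections would make the private endvertices adjacent whatever their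
    second coordinates are.\<close>
  have nonadjG: "{\<pi> e, \<pi> e'} \<notin> edges G" if "e \<in> B" "e' \<in> B" for e e'
    using nonadj[OF that] lV' that by (simp add: lex_product_edge_iff \<pi>_def)
  \<comment> \<open>Since \<open>l e\<close> lies on \<open>e\<close>, an edge is vertical exactly
    when its image under \<open>fst\<close> is the singleton of \<open>\<pi> e\<close>.\<close>
  have horiz: "fst ` e \<in> edges G" if e: "e \<in> B" "fst ` e \<noteq> {\<pi> e}" for e
  proof -
    obtain p q where pq: "e = {p, q}" using BE e(1) by (blast elim: edge_cases[OF P])
    then have "{fst p, fst q} \<in> edges G \<or> fst p = fst q"
      using BE that(1) by (auto simp: lex_product_edge_iff)
    then show ?thesis using pq that l[OF that(1)] by (auto simp: \<pi>_def)
  qed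
  \<comment> \<open>One non-vertical edge suffices for membership, so a fibre over \<open>X\<close>
    may mix both kinds of edges, while fibres over \<open>Y\<close> contain only vertical
    ones.\<close>
  define X where "X = {g \<in> \<pi> ` B. \<exists>e\<in>B. \<pi> e = g \<and> fst ` e \<noteq> {g}}"
  define Y where "Y = \<pi> ` B - X"
  have fin: "finite X" "finite Y" using finB by (auto simp: X_def Y_def)
  have XY: "X \<union> Y = \<pi> ` B" "X \<inter> Y = {}" by (auto simp: X_def Y_def)

  have "card (\<pi> ` B) \<le> independence_number G"
    using card_le_independence_number[OF G, of "\<pi> ` B"] lV' nonadjG
    by (force simp: indep_def \<pi>_def)
  then have XYle: "card X + card Y \<le> independence_number G"
    using card_Un_disjoint[OF fin XY(2)] XY(1) by simp

  have Xle: "card X \<le> eop_number G"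
  proof -
    \<comment> \<open>Choose one non-vertical edge \<open>r g\<close> for each point of
      \<open>X\<close>. The projections of these edges will form a packing of \<open>G\<close> with
      \<open>card X\<close> members.\<close>
    have "\<forall>g\<in>X. \<exists>e. e \<in> B \<and> \<pi> e = g \<and> fst ` e \<noteq> {g}" by (auto simp: X_def)
    then obtain r where r: "\<And>g. g \<in> X \<Longrightarrow> r g \<in> B" "\<And>g. g \<in> X \<Longrightarrow> \<pi> (r g) = g"
      "\<And>g. g \<in> X \<Longrightarrow> fst ` r g \<noteq> {g}" by metis
    have rE: "fst ` r g \<in> edges G" if "g \<in> X" for g
      using horiz[of "r g"] r that by simp
    have rin: "g \<in> fst ` r g" if "g \<in> X" for g
      using l[OF r(1)[OF that]] r(2)[OF that] by (metis \<pi>_def imageI)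
    \<comment> \<open>Two chosen edges with the same projection would make it
      \<open>{g, g'}\<close>, an edge between two points of the independent projected set.\<close>
    have "inj_on (\<lambda>g. fst ` r g) X"
    proof (rule inj_onI, rule ccontr)
      fix g g' assume a: "g \<in> X" "g' \<in> X" "fst ` r g = fst ` r g'" "g \<noteq> g'"
      obtain x y where "fst ` r g = {x, y}" by (rule edge_cases[OF G rE[OF a(1)]])
      then have "fst ` r g = {g, g'}" using rin[OF a(1)] rin[OF a(2)] a(3,4) by auto
      then show False using nonadjG[of "r g" "r g'"] rE[OF a(1)] r a(1,2) by simp
    qed
    moreover have "eop_set G ((\<lambda>g. fst ` r g) ` X)"
    proof (rule eop_setI)
      show "(\<lambda>g. fst ` r g) ` X \<subseteq> edges G" using rE by blast
    next
      fix d d' x y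
      assume "d \<in> (\<lambda>g. fst ` r g) ` X" "d' \<in> (\<lambda>g. fst ` r g) ` X" and ne: "d \<noteq> d'"
        and x: "x \<in> d" and y: "y \<in> d'" and xy: "{x, y} \<in> edges G"
      then obtain g g' where d: "g \<in> X" "d = fst ` r g" and d': "g' \<in> X" "d' = fst ` r g'" by blast
      obtain p where p: "p \<in> r g" "fst p = x" using x d by blast
      obtain q where q: "q \<in> r g'" "fst q = y" using y d' by blast
      have "p \<in> verts G \<times> verts H" "q \<in> verts G \<times> verts H"
        using BV r(1) d(1) d'(1) p(1) q(1) by blast+
      \<comment> \<open>Any edge of \<open>G\<close> lifts to an edge between arbitrary points above
        its ends, so the packing property in the product can be projected back.\<close>
      then have "{p, q} \<in> edges ?P" using xy p q by (simp add: lex_product_edge_iff)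
      then have "{p, q} = r g \<or> {p, q} = r g'"
        using eop_setD[OF B(1) r(1)[OF d(1)] r(1)[OF d'(1)] _ p(1) q(1)] ne d d' by blast
      then have "fst ` {p, q} = d \<or> fst ` {p, q} = d'" using d d' by auto
      then show "{x, y} = d \<or> {x, y} = d'" using p q by simp
    qed
    ultimately show ?thesis
      using card_le_eop_number[OF G, of "(\<lambda>g. fst ` r g) ` X"] by (simp add: card_image)
  qed

  \<comment> \<open>Within one fibre the private endvertices differ only in the second coordinate,
    and adjacency there is adjacency in \<open>H\<close>.\<close>
  have fibre_le_indep: "card {e \<in> B. \<pi> e = g} \<le> independence_number H" for g
  proof -
    let ?S = "(\<lambda>e. snd (l e)) ` {e \<in> B. \<pi> e = g}"
    have "inj_on (\<lambda>e. snd (l e)) {e \<in> B. \<pi> e = g}"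
      by (rule inj_onI) (use inj in \<open>auto simp: \<pi>_def inj_on_def prod_eq_iff\<close>)
    moreover have "?S \<subseteq> verts H" using lV' by fastforce
    moreover have "indep ?S (edges H)"
    proof -
      have "{snd (l e), snd (l e')} \<notin> edges H" if "e \<in> B" "e' \<in> B" "\<pi> e = \<pi> e'" for e e'
        using nonadj[OF that(1,2)] lV'[OF that(1)] lV'[OF that(2)] that(3)
        by (simp add: lex_product_edge_iff \<pi>_def)
      then show ?thesis by (auto simp: indep_def)
    qed
    ultimately show ?thesis
      using card_le_independence_number[OF H, of ?S] by (simp add: card_image)
  qed

  have fibre_le_eop: "card {e \<in> B. \<pi> e = g} \<le> eop_number H" if g: "g \<in> Y" for g
  proof -
    let ?C = "{e \<in> B. \<pi> e = g}"
    \<comment> \<open>A vertical edge over \<open>g\<close> is recovered from its second projection.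
      This gives injectivity and lets adjacencies in \<open>H\<close> be lifted to the copy of
      \<open>H\<close> above \<open>g\<close>.\<close>
    have vert: "e = Pair g ` snd ` e" if "e \<in> ?C" for e
    proof -
      have "fst ` e = {g}" using that g by (auto simp: X_def Y_def)
      then show ?thesis by (force simp: image_iff)
    qed
    have edge: "snd ` e \<in> edges H" if "e \<in> ?C" for e
    proof -
      have eB: "e \<in> B" using that by simp
      obtain p q where pq: "e = {p, q}" using BE eB by (blast elim: edge_cases[OF P])
      have "fst p = fst q" using vert[OF that] pq by (metis fst_conv imageE insertI1 insertI2)
      moreover have "{p, q} \<in> edges ?P" using pq BE eB by blast
      ultimately show ?thesis
        using pq edge_distinct[OF G, of "fst p" "fst q"] by (auto simp: lex_product_edge_iff)
    qed
    have "inj_on ((`) snd) ?C" by (rule inj_onI) (metis vert)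
    moreover have "eop_set H ((`) snd ` ?C)"
    proof (rule eop_setI)
      show "(`) snd ` ?C \<subseteq> edges H" using edge by blast
    next
      fix d d' x y
      assume "d \<in> (`) snd ` ?C" "d' \<in> (`) snd ` ?C" and ne: "d \<noteq> d'"
        and x: "x \<in> d" and y: "y \<in> d'" and xy: "{x, y} \<in> edges H"
      then obtain e e' where e: "e \<in> ?C" "d = snd ` e" and e': "e' \<in> ?C" "d' = snd ` e'" by blast
      have p: "(g, x) \<in> e" using vert[OF e(1)] x e(2) by blast
      have q: "(g, y) \<in> e'" using vert[OF e'(1)] y e'(2) by blast
      have "g \<in> verts G" using e(1) lV' by (force simp: \<pi>_def)
      moreover have "x \<in> verts H" "y \<in> verts H"
        using xy H unfolding finite_simple_graph_def nsets_def by blast+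
      ultimately have "{(g, x), (g, y)} \<in> edges ?P" using xy by (simp add: lex_product_edge_iff)
      then have "{(g, x), (g, y)} = e \<or> {(g, x), (g, y)} = e'"
        using eop_setD[OF B(1) _ _ _ p q] e e' ne by blast
      then show "{x, y} = d \<or> {x, y} = d'" using e(2) e'(2) by force
    qed
    ultimately show ?thesis
      using card_le_eop_number[OF H, of "(`) snd ` ?C"] by (simp add: card_image)
  qed

  let ?a = "independence_number H" and ?r = "eop_number H"
  have "card B = (\<Sum>g\<in>\<pi> ` B. card {e \<in> B. \<pi> e = g})"
    using sum.group[OF finB finite_imageI[OF finB] subset_refl, where h = "\<lambda>_. 1 :: nat" and g = \<pi>]
    by simp
  also have "\<dots> = (\<Sum>g\<in>X. card {e \<in> B. \<pi> e = g}) + (\<Sum>g\<in>Y. card {e \<in> B. \<pi> e = g})"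
    by (simp add: sum.union_disjoint[OF fin XY(2)] flip: XY(1))
  also have "\<dots> \<le> card X * ?a + card Y * ?r"
    using sum_bounded_above[of X "\<lambda>g. card {e \<in> B. \<pi> e = g}" ?a] fibre_le_indep
      sum_bounded_above[of Y "\<lambda>g. card {e \<in> B. \<pi> e = g}" ?r] fibre_le_eop
    by (intro add_mono) auto
  also have "\<dots> \<le> eop_number G * ?a + ?r * (independence_number G - eop_number G)"
  \<comment> \<open>With \<open>?a = ?r + k\<close>, the left side is
    \<open>(card X + card Y) * ?r + card X * k\<close>, which is monotone in
    \<open>card X + card Y\<close> and in \<open>card X\<close>. Bounding these by the independence
    number and the packing number of \<open>G\<close> gives the claim; writing the former as
    \<open>eop_number G + m\<close> removes the natural subtraction.\<close>
  proof -
    obtain k where k: "?a = ?r + k"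
      using eop_number_le_independence_number[OF H] le_Suc_ex by blast
    obtain m where m: "independence_number G = eop_number G + m"
      using eop_number_le_independence_number[OF G] le_Suc_ex by blast
    have "(card X + card Y) * ?r + card X * k \<le> (eop_number G + m) * ?r + eop_number G * k"
      using add_mono[OF mult_right_mono[OF XYle] mult_right_mono[OF Xle]] m by simp
    then show ?thesis by (simp add: k m algebra_simps)
  qed
  finally show ?thesis using B(2) by simp
qed

section \<open>Sharpness, witnessed by a single edge\<close>

lemma eop_number_single_edge:
  fixes x y :: 'a
  assumes "x \<noteq> y"
  defines "K \<equiv> ({x, y}, {{x, y}})"
  shows "finite_simple_graph K" "eop_number K = 1" "independence_number K = 1"
proof -
  show K: "finite_simple_graph K"
    using assms by (auto simp: finite_simple_graph_def nsets_def)
  have "eop_set K {{x, y}}" by (simp add: eop_set_def K_def)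
  from card_le_eop_number[OF K this] have "1 \<le> eop_number K" by simp
  moreover have "independence_number K \<le> 1"
  proof -
    obtain S where S: "S \<subseteq> verts K" "indep S (edges K)" "card S = independence_number K"
      by (rule independence_number_attained[OF K])
    have "S \<subseteq> {x} \<or> S \<subseteq> {y}" using S(1,2) assms(1) by (auto simp: K_def indep_def)
    then have "card S \<le> 1" by (auto dest!: subset_singletonD)
    then show ?thesis using S(3) by simp
  qed
  \<comment> \<open>Everything is squeezed: 1 is at most the packing number, which is at most the
    independence number, which is at most 1.\<close>
  ultimately show "eop_number K = 1" "independence_number K = 1"
    using eop_number_le_independence_number[OF K] by auto
qed


theorem theorem3p2:
  shows "(\<forall>(G :: 'a graph) (H :: 'b graph).
            finite_simple_graph G \<and> finite_simple_graph H \<longrightarrow>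
              int (eop_number G) * int (independence_number H)
                \<le> int (eop_number (lex_product G H)) \<and>
              int (eop_number (lex_product G H))
                \<le> int (eop_number G) * int (independence_number H)
                  + int (eop_number H) * (int (independence_number G) - int (eop_number G)))
       \<and> (\<exists>(G :: nat graph) (H :: nat graph).
            finite_simple_graph G \<and> verts G \<noteq> {} \<and>
            finite_simple_graph H \<and> verts H \<noteq> {} \<and>
              int (eop_number G) * int (independence_number H)
                = int (eop_number (lex_product G H)))
       \<and> (\<exists>(G :: nat graph) (H :: nat graph).
            finite_simple_graph G \<and> verts G \<noteq> {} \<and>
            finite_simple_graph H \<and> verts H \<noteq> {} \<and>
              int (eop_number (lex_product G H))
                = int (eop_number G) * int (independence_number H)
                  + int (eop_number H) * (int (independence_number G) - int (eop_number G)))"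
proof (intro conjI)
  show "\<forall>(G :: 'a graph) (H :: 'b graph).
            finite_simple_graph G \<and> finite_simple_graph H \<longrightarrow>
              int (eop_number G) * int (independence_number H)
                \<le> int (eop_number (lex_product G H)) \<and>
              int (eop_number (lex_product G H))
                \<le> int (eop_number G) * int (independence_number H)
                  + int (eop_number H) * (int (independence_number G) - int (eop_number G))"
  proof (intro allI impI, elim conjE)
    fix G :: "'a graph" and H :: "'b graph"
    assume G: "finite_simple_graph G" and H: "finite_simple_graph H"
    \<comment> \<open>The third fact ensures that the natural subtraction in the upper bound does
      not truncate, so it agrees with the integer one.\<close>
    from eop_number_lex_product_ge[OF G H] eop_number_lex_product_le[OF G H]
      eop_number_le_independence_number[OF G]
    show "int (eop_number G) * int (independence_number H) \<le> int (eop_number (lex_product G H)) \<and>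
          int (eop_number (lex_product G H)) \<le> int (eop_number G) * int (independence_number H)
            + int (eop_number H) * (int (independence_number G) - int (eop_number G))"
      by (simp flip: of_nat_mult of_nat_add of_nat_diff)
  qed
next
  let ?K = "({0, 1}, {{0, 1}}) :: nat graph"
  have K: "finite_simple_graph ?K" "eop_number ?K = 1" "independence_number ?K = 1"
    using eop_number_single_edge[of "0 :: nat" 1] by simp_all
  \<comment> \<open>The correction term is 0 here, so the lower and upper bounds are both 1.\<close>
  have "eop_number (lex_product ?K ?K) = 1"
    using eop_number_lex_product_ge[OF K(1) K(1)] eop_number_lex_product_le[OF K(1) K(1)] K(2,3)
    by simp
  with K show "\<exists>(G :: nat graph) (H :: nat graph).
            finite_simple_graph G \<and> verts G \<noteq> {} \<and>
            finite_simple_graph H \<and> verts H \<noteq> {} \<and>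
              int (eop_number G) * int (independence_number H)
                = int (eop_number (lex_product G H))"
    and "\<exists>(G :: nat graph) (H :: nat graph).
            finite_simple_graph G \<and> verts G \<noteq> {} \<and>
            finite_simple_graph H \<and> verts H \<noteq> {} \<and>
              int (eop_number (lex_product G H))
                = int (eop_number G) * int (independence_number H)
                  + int (eop_number H) * (int (independence_number G) - int (eop_number G))"
    by (intro exI[of _ ?K], simp)+
qed

end
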